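(* Let $1\le k\le n-1$. A point $x\in\mathring{\Delta}_{n,k}$ is a regular value of the moment map $\mu:G_{n,k}\to\Delta_{n,k}$ if and only if the preimage $\mu^{-1}(x)$ does not intersect any stratum which has a non-trivial stationary subgroup.
   Context: $G_{n,k}$ is the Grassmann manifold of $k$-dimensional complex subspaces of $\mathbb{C}^n$ with the action of $(\mathbb{C}^* )^n$ induced by the coordinatewise action; the diagonal acts trivially and one considers the effective action of $(\mathbb{C}^* )^{n-1}=(\mathbb{C}^* )^n/\mathrm{diag}(\mathbb{C}^* )$. $P^I(L)$, $I\subset\{1,\dots,n\}$, $|I|=k$, are the Pl\"ucker coordinates. For a set $\sigma$ of $k$-subsets, $W_\sigma=\{L:P^I(L)\ne0\iff I\in\sigma\}$, called a stratum if nonempty. All points of a stratum have the same stabilizer; its stationary subgroup is this common stabilizer in the effectively acting torus $(\mathbb{C}^* )^n/\mathrm{diag}(\mathbb{C}^* )$. The moment map is $\mu(L)=\frac{1}{\sum_I|P^I(L)|^2}\sum_I|P^I(L)|^2\Lambda_I$, where $\Lambda_I\in\mathbb{R}^n$ is the $0/1$ indicator vector of $I$; its image is the $(n-1)$-dimensional hypersimplex $\Delta_{n,k}=\{x\in[0,1]^n:\sum x_i=k\}$, with relative interior $\mathring{\Delta}_{n,k}$ in the hyperplane $\sum x_i=k$. A value $x$ is regular if $d\mu(L)$ has rank $n-1$ (i.e. is onto the tangent space of the hyperplane) for every $L\in\mu^{-1}(x)$. *)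

theory Defs
  imports "HOL-Algebra.Coset" "Jordan_Normal_Form.Determinant" "HOL-Analysis.Analysis"
begin

no_notation Matrix.vec_index (infixl \<open>$\<close> 100)

section \<open>Grassmannian and Pluecker coordinates\<close>

definition grassmannian :: "nat \<Rightarrow> (complex^'n) set set" where
  "grassmannian k = {L. vec.subspace L \<and> vec.dim L = k}"

definition is_basis :: "nat \<Rightarrow> (nat \<Rightarrow> complex^'n) \<Rightarrow> (complex^'n) set \<Rightarrow> bool" where
  "is_basis k b L \<longleftrightarrow>
     inj_on b {..<k} \<and> vec.independent (b ` {..<k}) \<and> vec.span (b ` {..<k}) = L"

definition ksubsets :: "nat \<Rightarrow> 'n set set" where
  "ksubsets k = {I. card I = k}"

definition minor :: "nat \<Rightarrow> (nat \<Rightarrow> complex^('n::{finite,linorder})) \<Rightarrow> 'n set \<Rightarrow> complex" where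
  "minor k b I =
     Determinant.det (Matrix.mat k k (\<lambda>(i, j). b i $ (sorted_list_of_set I ! j)))"

(* Pluecker coordinates are homogeneous: another basis multiplies all of them by one common
   nonzero scalar.  We fix one representative; the strata and the moment map do not depend
   on it. *)
definition pluecker :: "nat \<Rightarrow> (complex^('n::{finite,linorder})) set \<Rightarrow> 'n set \<Rightarrow> complex" where
  "pluecker k L = minor k (SOME b. is_basis k b L)"

section \<open>Torus action, strata, stationary subgroups\<close>

(* Multiplication and unit of complex^'n are the coordinatewise ones. *)
definition torus :: "(complex^'n) monoid" where
  "torus = \<lparr>carrier = {t. \<forall>i. t $ i \<noteq> 0}, monoid.mult = (*), one = 1\<rparr>"

definition diag_torus :: "(complex^'n) set" where
  "diag_torus = {(\<chi> i. c) | c. c \<noteq> 0}"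

definition effective_torus :: "(complex^'n) set monoid" where
  "effective_torus = torus Mod diag_torus"

definition torus_act :: "complex^'n \<Rightarrow> (complex^'n) set \<Rightarrow> (complex^'n) set" where
  "torus_act t L = (\<lambda>v. t * v) ` L"

(* The diagonal fixes every subspace, so all representatives t of a coset T act alike. *)
definition stabilizer :: "(complex^'n) set \<Rightarrow> (complex^'n) set set" where
  "stabilizer L = {T \<in> carrier effective_torus. \<forall>t\<in>T. torus_act t L = L}"

definition stratum :: "nat \<Rightarrow> 'n set set \<Rightarrow> (complex^('n::{finite,linorder})) set set" where
  "stratum k \<sigma> = {L \<in> grassmannian k. \<forall>I\<in>ksubsets k. pluecker k L I \<noteq> 0 \<longleftrightarrow> I \<in> \<sigma>}"

definition strata :: "nat \<Rightarrow> (complex^('n::{finite,linorder})) set set set" where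
  "strata k = {stratum k \<sigma> | \<sigma>. \<sigma> \<subseteq> ksubsets k \<and> stratum k \<sigma> \<noteq> {}}"

(* All points of a stratum S have the same stabilizer; the intersection is that common value. *)
definition stationary_subgroup :: "(complex^'n) set set \<Rightarrow> (complex^'n) set set" where
  "stationary_subgroup S = (\<Inter>L\<in>S. stabilizer L)"

section \<open>Moment map and hypersimplex\<close>

definition vertex :: "'n set \<Rightarrow> real^'n" where
  "vertex I = (\<chi> i. indicator I i)"

definition moment_map :: "nat \<Rightarrow> (complex^('n::{finite,linorder})) set \<Rightarrow> real^('n::{finite,linorder})" where
  "moment_map k L =
     (1 / (\<Sum>I\<in>ksubsets k. (cmod (pluecker k L I))\<^sup>2)) *\<^sub>R
     (\<Sum>I\<in>ksubsets k. (cmod (pluecker k L I))\<^sup>2 *\<^sub>R vertex I)"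

definition hypersimplex :: "nat \<Rightarrow> (real^'n) set" where
  "hypersimplex k = {x. (\<forall>i. 0 \<le> x $ i \<and> x $ i \<le> 1) \<and> (\<Sum>i\<in>UNIV. x $ i) = real k}"

section \<open>Smooth structure and regular values\<close>

(* The standard affine chart on {L. pluecker k L I \<noteq> 0}: each such L has a unique basis whose
   I-columns form the identity matrix, and its k(n-k) remaining entries are the coordinates.
   They are stored as the entries B $ i $ j with i in I and j not in I, all others being 0, so
   the coordinate space is a real linear subspace of complex^'n^'n of dimension 2k(n-k). *)
definition chart_space :: "'n set \<Rightarrow> (complex^'n^'n) set" where
  "chart_space I = {B. \<forall>i j. \<not> (i \<in> I \<and> j \<notin> I) \<longrightarrow> B $ i $ j = 0}"

definition chart_point :: "'n set \<Rightarrow> complex^'n^'n \<Rightarrow> (complex^'n) set" where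
  "chart_point I B = vec.span ((\<lambda>i. axis i 1 + B $ i) ` I)"

(* f is differentiable at L and its differential there has real rank r, read in an affine
   chart around L; the rank is independent of the chart.  The derivative D is determined only
   on the coordinate space (the tangent space), hence the rank is that of its restriction. *)
definition has_differential_rank ::
  "nat \<Rightarrow> ((complex^'n) set \<Rightarrow> 'b::euclidean_space) \<Rightarrow> (complex^'n) set \<Rightarrow> nat \<Rightarrow> bool" where
  "has_differential_rank k f L r \<longleftrightarrow>
     (\<exists>I\<in>ksubsets k. \<exists>B\<in>chart_space I. \<exists>D. chart_point I B = L \<and>
        ((\<lambda>C. f (chart_point I C)) has_derivative D) (at B within chart_space I) \<and>
        dim (D ` chart_space I) = r)"

definition regular_value :: "nat \<Rightarrow> real^('n::{finite,linorder}) \<Rightarrow> bool" where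
  "regular_value k x \<longleftrightarrow>
     (\<forall>L\<in>grassmannian k. moment_map k L = x \<longrightarrow>
        has_differential_rank k (moment_map k) L (CARD('n) - 1))"

end

theory Submission
  imports Defs
begin

text \<open>In an affine chart around \<open>L\<close> with coordinates \<open>B\<close>, a vector \<open>\<xi>\<close> is orthogonal to the image of
  \<open>d\<mu>(L)\<close> if and only if \<open>\<langle>\<Lambda>\<^sub>J, \<xi>\<rangle>\<close> is the same for all \<open>J\<close> with \<open>P\<^sup>J(L) \<noteq> 0\<close>, and this happens if and only if
  \<open>\<xi> $ i = \<xi> $ j\<close> whenever \<open>B $ i $ j \<noteq> 0\<close>.  A torus element \<open>t\<close> fixes \<open>L\<close> if and only if it satisfies
  these same equations.  They admit a nonconstant real solution exactly if they admit a nonconstant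
  solution in the torus, since both only depend on the connected components of the bipartite graph of
  nonzero entries of \<open>B\<close>.  Hence \<open>d\<mu>(L)\<close> has rank \<open>n - 1\<close> if and only if the stabilizer of \<open>L\<close> in the
  effective torus is trivial.\<close>

section \<open>Minors with respect to different bases\<close>

lemma is_basis_in: "is_basis k b L \<Longrightarrow> i < k \<Longrightarrow> b i \<in> L"
  by (auto simp: is_basis_def intro: vec.span_base)

lemma is_basis_coords:
  assumes "is_basis k b L" "v \<in> L"
  obtains a where "v = (\<Sum>i<k. a i *s b i)"
proof -
  have "v \<in> range (\<lambda>u. \<Sum>w\<in>b ` {..<k}. u w *s w)"
    using assms vec.span_finite[of "b ` {..<k}"] by (simp add: is_basis_def)
  then obtain u where "v = (\<Sum>w\<in>b ` {..<k}. u w *s w)" by auto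
  then have "v = (\<Sum>i<k. u (b i) *s b i)"
    using assms by (simp add: is_basis_def sum.reindex)
  then show ?thesis using that[of "\<lambda>i. u (b i)"] by simp
qed

lemma is_basis_sum_eq_0:
  assumes b: "is_basis k b L" and 0: "(\<Sum>i<k. a i *s b i) = 0" and "i < k"
  shows "a i = 0"
proof -
  have inj: "inj_on b {..<k}" using b by (simp add: is_basis_def)
  define u where "u = (\<lambda>w. a (the_inv_into {..<k} b w))"
  have "(\<Sum>w\<in>b ` {..<k}. u w *s w) = 0"
    using 0 inj by (simp add: sum.reindex u_def the_inv_into_f_f)
  then have "u (b i) = 0"
    using b \<open>i < k\<close> vec.independentD[of "b ` {..<k}" "b ` {..<k}" u "b i"]
    by (auto simp: is_basis_def)
  then show ?thesis using inj \<open>i < k\<close> by (simp add: u_def the_inv_into_f_f)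
qed

lemma is_basis_sum_in: "is_basis k b L \<Longrightarrow> (\<Sum>i<k. a i *s b i) \<in> L"
  unfolding is_basis_def by (metis (no_types, lifting) vec.span_base vec.span_scale vec.span_sum imageI)

text \<open>The minor is the determinant of the projection of \<open>L\<close> to the coordinates in
  \<open>J\<close>, written in the basis \<open>b\<close>, so it vanishes iff this projection has a
  kernel. The right-hand side no longer mentions \<open>b\<close>.\<close>

lemma minor_eq_0_iff:
  assumes b: "is_basis k b L" and J: "J \<in> ksubsets k"
  shows "minor k b J = 0 \<longleftrightarrow> (\<exists>v\<in>L. v \<noteq> 0 \<and> (\<forall>j\<in>J. v $ j = 0))"
proof -
  let ?s = "sorted_list_of_set J"
  define M where "M = Matrix.mat k k (\<lambda>(i, j). b i $ (?s ! j))"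
  have M: "M \<in> carrier_mat k k" by (simp add: M_def)
  have len: "length ?s = k" using J by (simp add: ksubsets_def)
  have J_nth: "(\<forall>j\<in>J. P j) \<longleftrightarrow> (\<forall>j<k. P (?s ! j))" for P
    using len by (metis in_set_conv_nth set_sorted_list_of_set finite)
  \<comment> \<open>The basis vectors are the rows of \<open>M\<close>, so it is the transpose that
    sends a coefficient vector \<open>x\<close> to the \<open>J\<close>-entries of
    \<open>w x\<close>.\<close>
  define w where "w x = (\<Sum>i<k. Matrix.vec_index x i *s b i)" for x
  have ker: "transpose_mat M *\<^sub>v x = 0\<^sub>v k \<longleftrightarrow> (\<forall>j\<in>J. w x $ j = 0)" if x: "x \<in> carrier_vec k" for x
  proof -
    have "Matrix.vec_index (transpose_mat M *\<^sub>v x) j = w x $ (?s ! j)" if "j < k" for j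
      using that x by (auto simp: M_def w_def scalar_prod_def mult.commute atLeast0LessThan intro!: sum.cong)
    moreover have "transpose_mat M *\<^sub>v x = 0\<^sub>v k \<longleftrightarrow> (\<forall>j<k. Matrix.vec_index (transpose_mat M *\<^sub>v x) j = 0)"
      using M by (auto simp: Matrix.vec_eq_iff)
    ultimately show ?thesis by (simp add: J_nth)
  qed
  have w0: "w x = 0 \<longleftrightarrow> x = 0\<^sub>v k" if "x \<in> carrier_vec k" for x
    using that is_basis_sum_eq_0[OF b, of "Matrix.vec_index x"]
    by (auto simp: w_def Matrix.vec_eq_iff)
  have "minor k b J = Determinant.det (transpose_mat M)"
    using Determinant.det_transpose[OF M] by (simp add: minor_def M_def)
  also have "\<dots> = 0 \<longleftrightarrow> (\<exists>x. x \<in> carrier_vec k \<and> x \<noteq> 0\<^sub>v k \<and> transpose_mat M *\<^sub>v x = 0\<^sub>v k)"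
    using M by (intro det_0_iff_vec_prod_zero) simp
  also have "\<dots> \<longleftrightarrow> (\<exists>x. x \<in> carrier_vec k \<and> w x \<noteq> 0 \<and> (\<forall>j\<in>J. w x $ j = 0))"
    using ker w0 by blast
  also have "\<dots> \<longleftrightarrow> (\<exists>v\<in>L. v \<noteq> 0 \<and> (\<forall>j\<in>J. v $ j = 0))"
  proof
    assume "\<exists>v\<in>L. v \<noteq> 0 \<and> (\<forall>j\<in>J. v $ j = 0)"
    then obtain v where v: "v \<in> L" "v \<noteq> 0" "\<forall>j\<in>J. v $ j = 0" by blast
    obtain a where "v = (\<Sum>i<k. a i *s b i)" using is_basis_coords[OF b v(1)] .
    then have "v = w (Matrix.vec k a)" by (simp add: w_def)
    then show "\<exists>x. x \<in> carrier_vec k \<and> w x \<noteq> 0 \<and> (\<forall>j\<in>J. w x $ j = 0)"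
      using v by (intro exI[of _ "Matrix.vec k a"]) auto
  qed (use is_basis_sum_in[OF b] in \<open>auto simp: w_def\<close>)
  finally show ?thesis .
qed

text \<open>The base change matrix multiplies the matrix of every minor from the left, so its
  determinant serves as \<open>c\<close> for all \<open>J\<close> at once.\<close>

lemma minor_change_basis:
  assumes b: "is_basis k b L" and b': "is_basis k b' L"
  obtains c where "\<And>J. J \<in> ksubsets k \<Longrightarrow> minor k b' J = c * minor k b J"
proof -
  have "\<exists>a. b' i = (\<Sum>l<k. a l *s b l)" if "i < k" for i
    using is_basis_coords[OF b is_basis_in[OF b' that]] by metis
  then obtain a where a: "\<And>i. i < k \<Longrightarrow> b' i = (\<Sum>l<k. a i l *s b l)" by metis
  define A where "A = Matrix.mat k k (\<lambda>(i, l). a i l)"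
  have "minor k b' J = Determinant.det A * minor k b J" if "J \<in> ksubsets k" for J
  proof -
    let ?s = "sorted_list_of_set J"
    have "Matrix.mat k k (\<lambda>(i, j). b' i $ (?s ! j)) = A * Matrix.mat k k (\<lambda>(i, j). b i $ (?s ! j))"
      by (rule eq_matI) (auto simp: A_def a scalar_prod_def atLeast0LessThan intro!: sum.cong)
    then show ?thesis by (simp add: minor_def det_mult[of _ k] A_def)
  qed
  then show ?thesis using that by blast
qed

lemma is_basis_exists:
  assumes "L \<in> grassmannian k"
  obtains b where "is_basis k b (L :: (complex^'n) set)"
proof -
  from assms have L: "vec.subspace L" "vec.dim L = k" by (auto simp: grassmannian_def)
  obtain S where S: "S \<subseteq> L" "vec.independent S" "L \<subseteq> vec.span S" "card S = vec.dim L"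
    using vec.basis_exists by blast
  have "finite S" using S(2) by (rule vec.independent_bound_general[THEN conjunct1])
  then obtain b where "bij_betw b {..<k} S"
    using S(4) L(2) by (metis card_lessThan finite_lessThan finite_same_card_bij)
  moreover have "vec.span S = L"
    using S L by (metis vec.span_subspace)
  ultimately have "is_basis k b L"
    using S by (auto simp: is_basis_def bij_betw_def)
  then show ?thesis using that by blast
qed

text \<open>Removes the choice in \<open>pluecker\<close>: from here on it is enough that some basis
  has these minors.\<close>

lemma pluecker_basis:
  assumes "is_basis k b L"
  shows "\<exists>b. is_basis k b L \<and> pluecker k L = minor k b"
  using someI[of "\<lambda>b. is_basis k b L", OF assms] by (auto simp: pluecker_def)

lemma pluecker_eq_0_iff:
  assumes "L \<in> grassmannian k" and "J \<in> ksubsets k"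
  shows "pluecker k L J = 0 \<longleftrightarrow> (\<exists>v\<in>L. v \<noteq> 0 \<and> (\<forall>j\<in>J. v $ j = 0))"
  using pluecker_basis minor_eq_0_iff is_basis_exists assms by metis

text \<open>The factor \<open>c\<close> between two bases enters numerator and denominator through
  its squared modulus and cancels. The nonzero minor at \<open>I\<close> excludes
  \<open>c = 0\<close>, because the vanishing of a minor depends on \<open>L\<close> only.\<close>

lemma moment_map_basis:
  assumes b: "is_basis k b L" and I: "I \<in> ksubsets k" "minor k b I \<noteq> 0"
  shows "moment_map k L =
     (1 / (\<Sum>J\<in>ksubsets k. (cmod (minor k b J))\<^sup>2)) *\<^sub>R
     (\<Sum>J\<in>ksubsets k. (cmod (minor k b J))\<^sup>2 *\<^sub>R vertex J)"
proof -
  obtain b' where b': "is_basis k b' L" "pluecker k L = minor k b'"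
    using pluecker_basis[OF b] by blast
  obtain c where c: "\<And>J. J \<in> ksubsets k \<Longrightarrow> minor k b' J = c * minor k b J"
    using minor_change_basis[OF b b'(1)] by blast
  have "minor k b' I \<noteq> 0"
    using I minor_eq_0_iff[OF b I(1)] minor_eq_0_iff[OF b'(1) I(1)] by blast
  then have "c \<noteq> 0" using c I by auto
  have "(\<Sum>J\<in>ksubsets k. (cmod (pluecker k L J))\<^sup>2) = (cmod c)\<^sup>2 * (\<Sum>J\<in>ksubsets k. (cmod (minor k b J))\<^sup>2)"
    using c by (simp add: b' norm_mult power_mult_distrib sum_distrib_left)
  moreover have "(\<Sum>J\<in>ksubsets k. (cmod (pluecker k L J))\<^sup>2 *\<^sub>R vertex J) =
      (cmod c)\<^sup>2 *\<^sub>R (\<Sum>J\<in>ksubsets k. (cmod (minor k b J))\<^sup>2 *\<^sub>R vertex J)"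
    using c by (simp add: b' norm_mult power_mult_distrib scaleR_sum_right)
  ultimately show ?thesis using \<open>c \<noteq> 0\<close> by (simp add: moment_map_def)
qed

text \<open>The torus scales column \<open>j\<close> by \<open>t $ j\<close>, which is right
  multiplication by a diagonal matrix.\<close>

lemma minor_torus:
  assumes "J \<in> ksubsets k"
  shows "minor k (\<lambda>i. t * b i) J = (\<Prod>j\<in>J. t $ j) * minor k b J"
proof -
  let ?s = "sorted_list_of_set J"
  have len: "length ?s = k" using assms by (simp add: ksubsets_def)
  let ?M = "Matrix.mat k k (\<lambda>(i, j). b i $ (?s ! j))"
  let ?D = "Matrix.mat k k (\<lambda>(i, j). if i = j then t $ (?s ! j) else 0)"
  have "Matrix.mat k k (\<lambda>(i, j). (t * b i) $ (?s ! j)) = ?M * ?D"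
    by (rule eq_matI) (auto simp: scalar_prod_def if_distrib mult.commute sum.delta cong: if_cong)
  moreover have "Determinant.det ?D = (\<Prod>j<k. t $ (?s ! j))"
    by (subst det_upper_triangular[of _ k])
       (auto simp: upper_triangular_def prod_list_diag_prod atLeast0LessThan)
  moreover have "(\<Prod>j<k. t $ (?s ! j)) = (\<Prod>j\<in>J. t $ j)"
    using len
    by (intro prod.reindex_bij_betw bij_betw_nth) auto
  ultimately show ?thesis by (simp add: minor_def det_mult[of _ k])
qed

section \<open>Affine charts\<close>

lemma chart_row_nth:
  assumes "B \<in> chart_space I" "i \<in> I"
  shows "(axis i 1 + B $ i) $ j = (if j \<in> I then if i = j then 1 else 0 else B $ i $ j)"
  using assms by (auto simp: chart_space_def axis_def)

text \<open>Both sides are linear in \<open>v\<close>, and on the spanning rows the equation holds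
  because their \<open>I\<close>-columns form the identity matrix. Thus a vector of a chart point is
  determined by its \<open>I\<close>-entries.\<close>

lemma chart_point_coords:
  assumes B: "B \<in> chart_space I" and v: "v \<in> chart_point I B"
  shows "(\<Sum>i\<in>I. v $ i *s (axis i 1 + B $ i)) = v"
proof -
  define r where "r = (\<lambda>i. axis i 1 + B $ i)"
  have r_nth: "r i $ j = (if i = j then 1 else 0)" if "i \<in> I" "j \<in> I" for i j
    using that by (simp add: r_def chart_row_nth[OF B] del: vector_add_component)
  have "v \<in> vec.span (r ` I)" using v by (simp add: chart_point_def r_def)
  then have "(\<Sum>i\<in>I. v $ i *s r i) = v"
  proof (induction rule: vec.span_induct)
    case base
    have "(\<Sum>i\<in>I. (c *s w) $ i *s r i) = c *s (\<Sum>i\<in>I. w $ i *s r i)" for c w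
      by (simp add: vec.scale_sum_right)
    then show ?case
      unfolding vec.subspace_def mem_Collect_eq
      by (simp only: vector_add_component vector_sadd_rdistrib sum.distrib) simp
  next
    case (step v)
    then obtain i where i: "i \<in> I" "v = r i" by blast
    have "(\<Sum>l\<in>I. v $ l *s r l) = (\<Sum>l\<in>I. if l = i then v else 0)"
      using i by (intro sum.cong) (auto simp: r_nth)
    then show ?case using i by simp
  qed
  then show ?thesis by (simp add: r_def)
qed

lemma chart_point_eqI:
  assumes "B \<in> chart_space I" "v \<in> chart_point I B" "w \<in> chart_point I B"
    and "\<And>i. i \<in> I \<Longrightarrow> v $ i = w $ i"
  shows "v = w"
  using assms chart_point_coords[of B I v] chart_point_coords[of B I w] by simp

text \<open>The rows are enumerated in the same increasing order in which \<open>minor\<close> reads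
  the columns of \<open>I\<close>, so that the \<open>I\<close>-minor is exactly 1, without a
  sign.\<close>

definition chart_basis ::
    "('n::{finite,linorder}) set \<Rightarrow> complex^('n::{finite,linorder})^('n::{finite,linorder}) \<Rightarrow> nat \<Rightarrow> complex^('n::{finite,linorder})" where
  "chart_basis I B l = (let i = sorted_list_of_set I ! l in axis i 1 + B $ i)"

lemma is_basis_chart:
  assumes I: "I \<in> ksubsets k" and B: "B \<in> chart_space I"
  shows "is_basis k (chart_basis I B) (chart_point I B)"
proof -
  let ?r = "\<lambda>i. axis i 1 + B $ i" and ?s = "sorted_list_of_set I"
  have s: "bij_betw ((!) ?s) {..<k} I"
    using I by (intro bij_betw_nth) (auto simp: ksubsets_def)
  have inj: "inj_on ?r I"
  proof (rule inj_onI)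
    fix i j assume ij: "i \<in> I" "j \<in> I" "?r i = ?r j"
    then have "?r i $ i = ?r j $ i" by simp
    then show "i = j"
      using ij(1,2) by (simp add: chart_row_nth[OF B] del: vector_add_component split: if_splits)
  qed
  have eq: "chart_basis I B = ?r \<circ> (!) ?s" by (simp add: chart_basis_def fun_eq_iff Let_def)
  have im: "chart_basis I B ` {..<k} = ?r ` I"
    using s unfolding eq image_comp[symmetric] by (simp add: bij_betw_def)
  have "inj_on (chart_basis I B) {..<k}"
    using s inj by (auto simp: eq bij_betw_def intro!: comp_inj_on)
  moreover have "vec.independent (?r ` I)"
  proof (rule vec.independent_if_scalars_zero)
    fix f x assume f: "(\<Sum>x\<in>?r ` I. f x *s x) = 0" and "x \<in> ?r ` I"
    then obtain i where i: "i \<in> I" "x = ?r i" by blast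
    have "0 = (\<Sum>l\<in>I. f (?r l) *s ?r l) $ i"
      using f inj by (simp add: sum.reindex)
    also have "\<dots> = (\<Sum>l\<in>I. f (?r l) * ?r l $ i)"
      by (simp only: sum_component vector_smult_component)
    also have "\<dots> = (\<Sum>l\<in>I. if l = i then f (?r l) else 0)"
      by (intro sum.cong) (use i chart_row_nth[OF B] in \<open>auto simp del: vector_add_component\<close>)
    finally show "f x = 0" using i by simp
  qed simp
  ultimately show ?thesis by (simp add: is_basis_def im chart_point_def)
qed

lemma minor_chart_basis:
  assumes I: "I \<in> ksubsets k" and B: "B \<in> chart_space I"
  shows "minor k (chart_basis I B) I = 1"
proof -
  let ?s = "sorted_list_of_set I"
  have len: "length ?s = k" using I by (simp add: ksubsets_def)
  then have "?s ! i \<in> I" if "i < k" for i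
    using that by (metis nth_mem set_sorted_list_of_set finite)
  then have "Matrix.mat k k (\<lambda>(i, j). chart_basis I B i $ (?s ! j)) = 1\<^sub>m k"
    using len by (intro eq_matI)
      (auto simp: chart_basis_def Let_def chart_row_nth[OF B] nth_eq_iff_index_eq simp del: vector_add_component)
  then show ?thesis by (simp add: minor_def)
qed

lemma is_basis_grassmannian: "is_basis k b L \<Longrightarrow> L \<in> grassmannian k"
  by (auto simp: is_basis_def grassmannian_def vec.dim_span_eq_card_independent card_image simp del: vec.dim_span)

text \<open>By Steinitz exchange, a basis of \<open>L\<close> extends by standard basis vectors to a
  basis of the whole space. The added vectors span a complement of \<open>L\<close>, and projecting
  the remaining standard vectors to \<open>L\<close> along it produces the rows of the
  chart.\<close>

lemma chart_exists:
  fixes L :: "(complex^('n::{finite,linorder})) set"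
  assumes L: "L \<in> grassmannian k"
  obtains I B where "I \<in> ksubsets k" "B \<in> chart_space I" "chart_point I B = L"
proof -
  have sub: "vec.subspace L" and dim: "vec.dim L = k" using L by (auto simp: grassmannian_def)
  obtain S where S: "S \<subseteq> L" "vec.independent S" "L \<subseteq> vec.span S" "card S = k"
    using vec.basis_exists[of L] dim by metis
  define A :: "(complex^('n::{finite,linorder})) set" where "A = range (\<lambda>i. axis i 1)"
  obtain T where T: "S \<subseteq> T" "T \<subseteq> S \<union> A" "vec.independent T" "S \<union> A \<subseteq> vec.span T"
    using vec.maximal_independent_subset_extend[of S "S \<union> A"] S(2) by auto
  have finT: "finite T" using T(3) by (simp add: vec.independent_explicit)
  have full: "vec.span T = UNIV"
  proof -
    have "cart_basis \<subseteq> vec.span T" using T(4) by (auto simp: cart_basis_def A_def)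
    then show ?thesis using span_cart_basis vec.span_minimal[OF _ vec.subspace_span] by blast
  qed
  then have cardT: "card T = CARD('n)"
    using vec.dim_span_eq_card_independent[OF T(3)] vec_dim_card[where 'a=complex and 'n='n] by simp
  \<comment> \<open>The indices of the standard vectors that were not added; the complement spanned
    by \<open>T - S\<close> then consists of vectors vanishing on \<open>I\<close>.\<close>
  define I where "I = {i. axis i 1 \<notin> T - S}"
  have Q: "T - S = (\<lambda>j. axis j 1) ` (- I)"
    using T(2) by (auto simp: I_def A_def)
  have inj: "inj_on (\<lambda>j. axis j (1::complex)) X" for X :: "('n::{finite,linorder}) set"
    by (auto simp: inj_on_def axis_eq_axis)
  have "card (- I) = CARD('n) - k"
    using Q inj T(1) cardT S(4) card_image[OF inj, of "- I"] finT
    by (metis card_Diff_subset finite_subset)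
  moreover have "k \<le> CARD('n)"
    using cardT S(4) T(1) finT by (metis card_mono)
  ultimately have "card I = k"
    using card_Un_disjoint[of I "- I"] by (simp add: Compl_partition)
  then have I: "I \<in> ksubsets k" by (simp add: ksubsets_def)
  have "\<exists>r. r \<in> L \<and> (\<forall>i'\<in>I. r $ i' = (if i = i' then 1 else 0))" if "i \<in> I" for i
  proof -
    have "S \<union> (T - S) = T" using T(1) by blast
    then have "axis i 1 \<in> {x + y |x y. x \<in> vec.span S \<and> y \<in> vec.span (T - S)}"
      using full by (simp flip: vec.span_Un)
    then obtain r q where rq: "axis i 1 = r + q" "r \<in> vec.span S" "q \<in> vec.span (T - S)"
      by blast
    \<comment> \<open>Hence the component \<open>r\<close> in \<open>L\<close> has the same
      \<open>I\<close>-entries as \<open>axis i 1\<close>.\<close>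
    have "q $ i' = 0" if "i' \<in> I" for i'
      using rq(3)
    proof (induction rule: vec.span_induct)
      case base
      show ?case by (auto simp: vec.subspace_def)
    next
      case (step x)
      then show ?case using Q that by (auto simp: axis_def)
    qed
    moreover have "r \<in> L" using rq(2) S(1) sub vec.span_minimal by blast
    moreover have "r = axis i 1 - q" using rq(1) by simp
    ultimately show ?thesis by (intro exI[of _ r]) (auto simp: axis_def)
  qed
  then obtain r where r: "\<And>i. i \<in> I \<Longrightarrow> r i \<in> L"
    "\<And>i i'. i \<in> I \<Longrightarrow> i' \<in> I \<Longrightarrow> r i $ i' = (if i = i' then 1 else 0)"
    by metis
  define B where "B = (\<chi> i. if i \<in> I then r i - axis i 1 else 0)"
  have B: "B \<in> chart_space I"
    by (auto simp: B_def chart_space_def r(2) axis_def)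
  have "chart_point I B \<subseteq> L"
    unfolding chart_point_def using r(1) sub by (intro vec.span_minimal) (auto simp: B_def)
  moreover have "vec.dim (chart_point I B) = k"
    using is_basis_grassmannian[OF is_basis_chart[OF I B]] by (simp add: grassmannian_def)
  ultimately have "chart_point I B = L"
    using sub dim vec.subspace_dim_equal[of "chart_point I B" L] by (simp add: chart_point_def)
  then show ?thesis using that I B by blast
qed

section \<open>Coordinates along the edges of a chart\<close>

text \<open>The edges are those of the bipartite graph between \<open>I\<close> and its complement
  given by the nonzero entries of \<open>B\<close>. The entry type is left open because both real
  vectors and torus elements are tested.\<close>

definition edge_const :: "'n set \<Rightarrow> complex^'n^'n \<Rightarrow> 'a^'n \<Rightarrow> bool" where
  "edge_const I B t \<longleftrightarrow> (\<forall>i\<in>I. \<forall>j. j \<notin> I \<longrightarrow> B $ i $ j \<noteq> 0 \<longrightarrow> t $ i = t $ j)"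

text \<open>Up to sign, the minor at the exchanged set is \<open>B $ i $ j\<close>. The kernel
  criterion yields its nonvanishing without the sign: a vector of the chart point vanishing on
  \<open>I - {i}\<close> is a multiple of row \<open>i\<close>, and its \<open>j\<close>-entry is
  that multiple of \<open>B $ i $ j\<close>.\<close>

lemma pluecker_chart:
  assumes "I \<in> ksubsets k" "B \<in> chart_space I"
  shows "pluecker k (chart_point I B) I \<noteq> 0"
    and "\<lbrakk>i \<in> I; j \<notin> I; B $ i $ j \<noteq> 0\<rbrakk> \<Longrightarrow> insert j (I - {i}) \<in> ksubsets k"
    and "\<lbrakk>i \<in> I; j \<notin> I; B $ i $ j \<noteq> 0\<rbrakk> \<Longrightarrow> pluecker k (chart_point I B) (insert j (I - {i})) \<noteq> 0"
proof -
  note b = is_basis_chart[OF assms]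
  note L = is_basis_grassmannian[OF b]
  show "pluecker k (chart_point I B) I \<noteq> 0"
    using minor_chart_basis[OF assms] minor_eq_0_iff[OF b assms(1)]
      pluecker_eq_0_iff[OF L assms(1)] by simp
  assume ij: "i \<in> I" "j \<notin> I" "B $ i $ j \<noteq> 0"
  show J: "insert j (I - {i}) \<in> ksubsets k"
    using ij assms(1) by (auto simp: ksubsets_def card_Suc_Diff1 simp del: card_Diff_insert)
  show "pluecker k (chart_point I B) (insert j (I - {i})) \<noteq> 0"
    unfolding pluecker_eq_0_iff[OF L J]
  proof clarify
    fix v assume v: "v \<in> chart_point I B" "\<forall>l\<in>insert j (I - {i}). v $ l = 0" "v \<noteq> 0"
    have "v = (\<Sum>l\<in>I. v $ l *s (axis l 1 + B $ l))"
      by (rule chart_point_coords[OF assms(2) v(1), symmetric])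
    also have "\<dots> = (\<Sum>l\<in>I. if l = i then v $ i *s (axis i 1 + B $ i) else 0)"
      using v(2) by (intro sum.cong) auto
    finally have v_eq: "v $ i *s (axis i 1 + B $ i) = v" using ij by simp
    then have "v $ j = v $ i * B $ i $ j"
      using chart_row_nth[OF assms(2) ij(1), of j] ij(2) by (metis vector_smult_component)
    then have "v $ i = 0" using v(2) ij by simp
    then show False using v_eq v(3) by simp
  qed
qed

text \<open>For an edge from \<open>i\<close> to \<open>j\<close>, both \<open>I\<close> and
  \<open>insert j (I - {i})\<close> carry nonzero Pluecker coordinates, and their products differ
  only in the factors \<open>t $ i\<close> and \<open>t $ j\<close>.\<close>

lemma edge_const_if_prod_const:
  fixes t :: "complex^('n::{finite,linorder})"
  assumes "I \<in> ksubsets k" "B \<in> chart_space I" and t: "\<And>i. t $ i \<noteq> 0"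
    and c: "\<And>J. J \<in> ksubsets k \<Longrightarrow> pluecker k (chart_point I B) J \<noteq> 0 \<Longrightarrow> (\<Prod>j\<in>J. t $ j) = c"
  shows "edge_const I B t"
  unfolding edge_const_def
proof (intro ballI allI impI)
  fix i j assume ij: "i \<in> I" "j \<notin> I" "B $ i $ j \<noteq> 0"
  have "t $ i * (\<Prod>l\<in>I - {i}. t $ l) = (\<Prod>l\<in>I. t $ l)"
    using ij by (simp add: prod.remove)
  also have "\<dots> = (\<Prod>l\<in>insert j (I - {i}). t $ l)"
    using c[OF assms(1) pluecker_chart(1)[OF assms(1,2)]] c[OF pluecker_chart(2,3)[OF assms(1,2) ij]]
    by simp
  also have "\<dots> = t $ j * (\<Prod>l\<in>I - {i}. t $ l)"
    using ij by simp
  finally show "t $ i = t $ j" using t by simp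
qed

text \<open>The additive analogue, by the same exchange of \<open>i\<close> for
  \<open>j\<close>.\<close>

lemma edge_const_if_sum_const:
  fixes \<xi> :: "real^('n::{finite,linorder})"
  assumes "I \<in> ksubsets k" "B \<in> chart_space I"
    and c: "\<And>J. J \<in> ksubsets k \<Longrightarrow> pluecker k (chart_point I B) J \<noteq> 0 \<Longrightarrow> (\<Sum>j\<in>J. \<xi> $ j) = c"
  shows "edge_const I B \<xi>"
  unfolding edge_const_def
proof (intro ballI allI impI)
  fix i j assume ij: "i \<in> I" "j \<notin> I" "B $ i $ j \<noteq> 0"
  have "\<xi> $ i + (\<Sum>l\<in>I - {i}. \<xi> $ l) = (\<Sum>l\<in>I. \<xi> $ l)"
    using ij by (simp add: sum.remove)
  also have "\<dots> = (\<Sum>l\<in>insert j (I - {i}). \<xi> $ l)"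
    using c[OF assms(1) pluecker_chart(1)[OF assms(1,2)]] c[OF pluecker_chart(2,3)[OF assms(1,2) ij]]
    by simp
  also have "\<dots> = \<xi> $ j + (\<Sum>l\<in>I - {i}. \<xi> $ l)"
    using ij by simp
  finally show "\<xi> $ i = \<xi> $ j" by simp
qed

section \<open>The torus action in chart coordinates\<close>

lemma linear_torus: "Vector_Spaces.linear (*s) (*s) ((*) (t :: complex^'n))"
  by (intro Vector_Spaces.linear.intro vec.vector_space_axioms module_hom.intro vec.module_axioms
      module_hom_axioms.intro) (auto simp: vec_eq_iff algebra_simps)

lemma inj_torus: "(\<And>i. t $ i \<noteq> 0) \<Longrightarrow> inj ((*) (t :: complex^'n))"
  by (auto simp: inj_def vec_eq_iff)

lemma torus_act_span: "torus_act t (vec.span S) = vec.span ((*) t ` S)"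
  unfolding torus_act_def by (rule vec.linear_span_image[OF linear_torus, symmetric])

lemma is_basis_torus:
  assumes b: "is_basis k b L" and t: "\<And>i. t $ i \<noteq> 0"
  shows "is_basis k (\<lambda>i. t * b i) (torus_act t L)"
proof -
  have im: "(\<lambda>i. t * b i) ` {..<k} = (*) t ` b ` {..<k}" by auto
  have "inj_on (\<lambda>i. t * b i) {..<k}"
    using b inj_torus[OF t] by (auto simp: is_basis_def inj_on_def)
  moreover have "vec.independent ((*) t ` b ` {..<k})"
    using b inj_on_subset[OF inj_torus[OF t]]
    by (intro vec.linear_independent_injective_image[OF linear_torus]) (auto simp: is_basis_def)
  ultimately show ?thesis
    using b torus_act_span by (auto simp: is_basis_def im)
qed

text \<open>In the chart the torus acts by multiplying the entry at \<open>i\<close>,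
  \<open>j\<close> with \<open>t $ j / t $ i\<close>; the hypothesis on \<open>C\<close> states this
  without division. Row \<open>i\<close> of \<open>B\<close> is sent to \<open>t $ i\<close> times
  row \<open>i\<close> of \<open>C\<close>, and the inclusion so obtained is an equality by
  dimension.\<close>

lemma torus_act_chart_point:
  fixes t :: "complex^('n::{finite,linorder})"
  assumes I: "I \<in> ksubsets k" and B: "B \<in> chart_space I" and C: "C \<in> chart_space I"
    and t: "\<And>i. t $ i \<noteq> 0"
    and BC: "\<And>i j. i \<in> I \<Longrightarrow> j \<notin> I \<Longrightarrow> t $ j * B $ i $ j = t $ i * C $ i $ j"
  shows "torus_act t (chart_point I B) = chart_point I C"
proof -
  let ?R = "\<lambda>i. axis i 1 + C $ i"
  have row: "t * (axis i 1 + B $ i) = t $ i *s ?R i" if "i \<in> I" for i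
    using that
    by (auto simp: vec_eq_iff BC chart_row_nth[OF B that] chart_row_nth[OF C that]
        simp del: vector_add_component vector_add_ldistrib vec.scale_right_distrib)
  have "(*) t ` (\<lambda>i. axis i 1 + B $ i) ` I \<subseteq> vec.span (?R ` I)"
  proof clarify
    fix i assume "i \<in> I"
    then show "t * (axis i 1 + B $ i) \<in> vec.span (?R ` I)"
      unfolding row[OF \<open>i \<in> I\<close>] by (intro vec.span_scale vec.span_base) auto
  qed
  then have "torus_act t (chart_point I B) \<subseteq> chart_point I C"
    unfolding chart_point_def torus_act_span using vec.span_minimal vec.subspace_span by blast
  moreover have "torus_act t (chart_point I B) \<in> grassmannian k" "chart_point I C \<in> grassmannian k"
    using is_basis_chart[OF I B] is_basis_chart[OF I C] is_basis_torus[OF _ t] is_basis_grassmannian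
    by blast+
  ultimately show ?thesis
    using vec.subspace_dim_equal[of "torus_act t (chart_point I B)" "chart_point I C"]
    by (simp add: grassmannian_def)
qed

text \<open>If the subspace is fixed, then for each row \<open>r\<close> at index \<open>i\<close>
  it contains \<open>t * r\<close> and \<open>t $ i *s r\<close>, which have the same
  \<open>I\<close>-entries and hence agree; comparing the entries at \<open>j\<close> gives the edge
  equation. Conversely, the edge equations say that the action maps \<open>B\<close> to
  itself.\<close>

lemma torus_act_chart_point_iff:
  fixes t :: "complex^('n::{finite,linorder})"
  assumes I: "I \<in> ksubsets k" and B: "B \<in> chart_space I" and t: "\<And>i. t $ i \<noteq> 0"
  shows "torus_act t (chart_point I B) = chart_point I B \<longleftrightarrow> edge_const I B t"
proof
  assume fixed: "torus_act t (chart_point I B) = chart_point I B"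
  show "edge_const I B t"
    unfolding edge_const_def
  proof (intro ballI allI impI)
    fix i j assume ij: "i \<in> I" "j \<notin> I" "B $ i $ j \<noteq> 0"
    let ?r = "axis i 1 + B $ i"
    have r: "?r \<in> chart_point I B"
      unfolding chart_point_def using ij by (intro vec.span_base) auto
    have "t * ?r = t $ i *s ?r"
    proof (rule chart_point_eqI[OF B])
      show "t * ?r \<in> chart_point I B" using fixed r unfolding torus_act_def by blast
      show "t $ i *s ?r \<in> chart_point I B"
        using r unfolding chart_point_def by (rule vec.span_scale)
      show "(t * ?r) $ l = (t $ i *s ?r) $ l" if "l \<in> I" for l
        using that
        by (simp add: chart_row_nth[OF B ij(1)] del: vector_add_component vector_add_ldistrib vec.scale_right_distrib)
    qed
    then have "t $ j * ?r $ j = t $ i * ?r $ j" by (metis vector_mult_component vector_smult_component)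
    then show "t $ i = t $ j"
      using ij by (simp add: chart_row_nth[OF B ij(1)] del: vector_add_component)
  qed
next
  assume const: "edge_const I B t"
  have "t $ j * B $ i $ j = t $ i * B $ i $ j" if "i \<in> I" "j \<notin> I" for i j
  proof -
    have "B $ i $ j \<noteq> 0 \<Longrightarrow> t $ i = t $ j" using const that unfolding edge_const_def by blast
    then show ?thesis by (cases "B $ i $ j = 0") auto
  qed
  then show "torus_act t (chart_point I B) = chart_point I B"
    by (rule torus_act_chart_point[OF I B B t])
qed

section \<open>Stabilizers and the support of the Pluecker coordinates\<close>

text \<open>The translate of a basis of \<open>L\<close> is again a basis of \<open>L\<close>, so
  all minors change by one common scalar; on the support this scalar is the product of the
  \<open>t $ j\<close>.\<close>

lemma prod_const_if_torus_fixed: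
  assumes L: "L \<in> grassmannian k" and t: "\<And>i. t $ i \<noteq> 0" and fixed: "torus_act t L = L"
  obtains c where "\<And>J. J \<in> ksubsets k \<Longrightarrow> pluecker k L J \<noteq> 0 \<Longrightarrow> (\<Prod>j\<in>J. t $ j) = c"
proof -
  obtain b where b: "is_basis k b L" "pluecker k L = minor k b"
    using pluecker_basis is_basis_exists[OF L] by metis
  obtain c where "\<And>J. J \<in> ksubsets k \<Longrightarrow> minor k (\<lambda>i. t * b i) J = c * minor k b J"
    using minor_change_basis[OF b(1)] is_basis_torus[OF b(1) t] fixed by metis
  then show ?thesis using that[of c] by (auto simp: b(2) minor_torus)
qed

text \<open>Being fixed passes to constant products over the support of \<open>L\<close>, hence over
  the smaller support of \<open>L'\<close>, and from there back to being fixed through a chart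
  around \<open>L'\<close>. This is why a stratum has one common stabilizer.\<close>

lemma torus_fixed_same_support:
  assumes L: "L \<in> grassmannian k" and L': "L' \<in> grassmannian k"
    and supp: "\<And>J. J \<in> ksubsets k \<Longrightarrow> pluecker k L' J \<noteq> 0 \<Longrightarrow> pluecker k L J \<noteq> 0"
    and t: "\<And>i. t $ i \<noteq> 0" and fixed: "torus_act t L = L"
  shows "torus_act t L' = L'"
proof -
  obtain I B where IB: "I \<in> ksubsets k" "B \<in> chart_space I" "chart_point I B = L'"
    using chart_exists[OF L'] .
  obtain c where "\<And>J. J \<in> ksubsets k \<Longrightarrow> pluecker k L J \<noteq> 0 \<Longrightarrow> (\<Prod>j\<in>J. t $ j) = c"
    using prod_const_if_torus_fixed[OF L t fixed] by blast
  then have "edge_const I B t"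
    using IB supp by (intro edge_const_if_prod_const[of I k B t c] t) auto
  then show ?thesis using torus_act_chart_point_iff[OF IB(1,2) t] IB(3) by simp
qed

text \<open>The exponential map onto the positive real part of the torus; it converts additive
  conditions on \<open>\<xi>\<close> into multiplicative ones and is injective.\<close>

definition torus_exp :: "real^'n \<Rightarrow> complex^'n" where
  "torus_exp \<xi> = (\<chi> i. of_real (exp (\<xi> $ i)))"

lemma torus_exp_nz: "torus_exp \<xi> $ i \<noteq> 0"
  by (simp add: torus_exp_def)

lemma prod_torus_exp: "(\<Prod>j\<in>J. torus_exp \<xi> $ j) = of_real (exp (\<Sum>j\<in>J. \<xi> $ j))"
  by (simp add: torus_exp_def exp_sum)

text \<open>The exponential of \<open>\<xi>\<close> satisfies the edge equations too, so it fixes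
  the chart point and its products over the support are constant; injectivity of \<open>exp\<close>
  returns to the sums.\<close>

lemma sum_const_if_edge_const:
  fixes \<xi> :: "real^('n::{finite,linorder})"
  assumes I: "I \<in> ksubsets k" and B: "B \<in> chart_space I" and "edge_const I B \<xi>"
  obtains c where "\<And>J. J \<in> ksubsets k \<Longrightarrow> pluecker k (chart_point I B) J \<noteq> 0 \<Longrightarrow> (\<Sum>j\<in>J. \<xi> $ j) = c"
proof -
  let ?t = "torus_exp \<xi>"
  have "edge_const I B ?t" using assms(3) by (auto simp: edge_const_def torus_exp_def)
  then have "torus_act ?t (chart_point I B) = chart_point I B"
    using torus_act_chart_point_iff[OF I B torus_exp_nz] by blast
  then obtain c where c: "\<And>J. J \<in> ksubsets k \<Longrightarrow> pluecker k (chart_point I B) J \<noteq> 0 \<Longrightarrow>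
      complex_of_real (exp (\<Sum>j\<in>J. \<xi> $ j)) = c"
    using prod_const_if_torus_fixed[OF is_basis_grassmannian[OF is_basis_chart[OF I B]] torus_exp_nz]
    by (metis prod_torus_exp)
  have "(\<Sum>j\<in>J. \<xi> $ j) = (\<Sum>j\<in>I. \<xi> $ j)"
    if "J \<in> ksubsets k" "pluecker k (chart_point I B) J \<noteq> 0" for J
    using c[OF that] c[OF I pluecker_chart(1)[OF I B]] by (metis exp_inj_iff of_real_eq_iff)
  then show ?thesis using that by blast
qed

no_notation Matrix.scalar_prod (infix \<open>\<bullet>\<close> 70)

section \<open>The differential of the moment map in a chart\<close>

lemma differentiable_prod:
  fixes f :: "'i \<Rightarrow> 'a::real_normed_vector \<Rightarrow> 'b::real_normed_field"
  assumes "\<And>i. i \<in> I \<Longrightarrow> f i differentiable (at x within S)"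
  shows "(\<lambda>x. \<Prod>i\<in>I. f i x) differentiable (at x within S)"
proof -
  obtain f' where "\<And>i. i \<in> I \<Longrightarrow> (f i has_derivative f' i) (at x within S)"
    using assms unfolding differentiable_def by metis
  then show ?thesis unfolding differentiable_def by (blast intro: has_derivative_prod)
qed

text \<open>By the Leibniz formula the determinant is a polynomial in the entries.\<close>

lemma differentiable_det:
  fixes f :: "'a::real_normed_vector \<Rightarrow> nat \<Rightarrow> nat \<Rightarrow> 'b::real_normed_field"
  assumes "\<And>i j. i < k \<Longrightarrow> j < k \<Longrightarrow> (\<lambda>x. f x i j) differentiable (at x within S)"
  shows "(\<lambda>x. Determinant.det (Matrix.mat k k (\<lambda>(i, j). f x i j))) differentiable (at x within S)"
proof -
  have perm: "p i < k" if "p permutes {0..<k}" "i < k" for p i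
    using permutes_in_image[OF that(1), of i] that(2) by simp
  have "(\<lambda>x. \<Sum>p\<in>{p. p permutes {0..<k}}. signof p * (\<Prod>i = 0..<k. f x i (p i)))
      differentiable (at x within S)"
    using assms
    by (intro differentiable_sum ballI differentiable_mult differentiable_prod finite_permutations)
       (auto simp: perm)
  moreover have "Determinant.det (Matrix.mat k k (\<lambda>(i, j). f x i j)) =
      (\<Sum>p\<in>{p. p permutes {0..<k}}. signof p * (\<Prod>i = 0..<k. f x i (p i)))" for x
    by (subst det_def'[of _ k])
       (auto intro!: sum.cong prod.cong arg_cong2[of _ _ _ _ "(*)"] simp: perm)
  ultimately show ?thesis by simp
qed

text \<open>The minors are taken in the chart basis, which varies smoothly with \<open>B\<close>,
  whereas the basis chosen in \<open>pluecker\<close> comes with no continuity.\<close>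

definition weight ::
    "nat \<Rightarrow> 'n set \<Rightarrow> complex^('n::{finite,linorder})^('n::{finite,linorder}) \<Rightarrow> 'n set \<Rightarrow> real" where
  "weight k I B J = (cmod (minor k (chart_basis I B) J))\<^sup>2"

lemma weight_differentiable: "(\<lambda>C. weight k I C J) differentiable (at B within S)"
proof -
  have "(\<lambda>C. minor k (chart_basis I C) J) differentiable (at B within S)"
    unfolding minor_def chart_basis_def Let_def vector_add_component
    by (intro differentiable_det differentiable_add differentiable_const bounded_linear_imp_differentiable
        bounded_linear_compose[OF bounded_linear_vec_nth bounded_linear_vec_nth])
  then show ?thesis
    \<comment> \<open>The modulus is not differentiable at 0, but its square is an inner
      product.\<close>
    unfolding weight_def power2_norm_eq_inner by (intro differentiable_inner)
qed

lemma weight_nonneg: "weight k I B J \<ge> 0"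
  by (simp add: weight_def)

lemma weight_eq_0_iff:
  assumes "I \<in> ksubsets k" "B \<in> chart_space I" "J \<in> ksubsets k"
  shows "weight k I B J = 0 \<longleftrightarrow> pluecker k (chart_point I B) J = 0"
  using minor_eq_0_iff[OF is_basis_chart[OF assms(1,2)] assms(3)]
    pluecker_eq_0_iff[OF is_basis_grassmannian[OF is_basis_chart[OF assms(1,2)]] assms(3)]
  by (simp add: weight_def)

text \<open>The summand at \<open>I\<close> is \<open>c I\<close>, since the weight there is 1. The
  factor \<open>c\<close> leaves room for exponentials along torus orbits.\<close>

lemma sum_weight_pos:
  assumes "I \<in> ksubsets k" "B \<in> chart_space I" "\<And>J. c J > 0"
  shows "(\<Sum>J\<in>ksubsets k. weight k I B J * c J) > 0"
  using assms minor_chart_basis[OF assms(1,2)]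
  by (intro sum_pos2[of _ I]) (auto simp: weight_def less_imp_le)

lemma inner_vertex: "vertex I \<bullet> \<xi> = (\<Sum>i\<in>I. \<xi> $ i)"
proof -
  have "vertex I \<bullet> \<xi> = (\<Sum>i\<in>UNIV. if i \<in> I then \<xi> $ i else 0)"
    unfolding inner_vec_def by (intro sum.cong) (auto simp: vertex_def)
  then show ?thesis by (simp add: sum.If_cases)
qed

lemma moment_map_chart:
  assumes "I \<in> ksubsets k" "B \<in> chart_space I"
  shows "moment_map k (chart_point I B) =
     (1 / (\<Sum>J\<in>ksubsets k. weight k I B J)) *\<^sub>R (\<Sum>J\<in>ksubsets k. weight k I B J *\<^sub>R vertex J)"
  using moment_map_basis[OF is_basis_chart[OF assms] assms(1)] minor_chart_basis[OF assms]
  by (simp add: weight_def)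

lemma moment_map_chart_inner:
  assumes "I \<in> ksubsets k" "B \<in> chart_space I"
  shows "moment_map k (chart_point I B) \<bullet> \<xi> =
     (\<Sum>J\<in>ksubsets k. weight k I B J * (\<Sum>j\<in>J. \<xi> $ j)) / (\<Sum>J\<in>ksubsets k. weight k I B J)"
  by (simp add: moment_map_chart[OF assms] inner_sum_left inner_vertex)

lemma moment_map_chart_differentiable:
  assumes I: "I \<in> ksubsets k" and B: "B \<in> chart_space I"
  shows "\<exists>D. ((\<lambda>C. moment_map k (chart_point I C)) has_derivative D) (at B within chart_space I)"
proof -
  have "(\<lambda>C. (1 / (\<Sum>J\<in>ksubsets k. weight k I C J)) *\<^sub>R (\<Sum>J\<in>ksubsets k. weight k I C J *\<^sub>R vertex J))
      differentiable (at B within chart_space I)"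
    using sum_weight_pos[OF I B, of "\<lambda>_. 1"]
    by (intro differentiable_scaleR differentiable_divide differentiable_const differentiable_sum
        ballI weight_differentiable) auto
  then obtain D where "((\<lambda>C. (1 / (\<Sum>J\<in>ksubsets k. weight k I C J)) *\<^sub>R
      (\<Sum>J\<in>ksubsets k. weight k I C J *\<^sub>R vertex J)) has_derivative D) (at B within chart_space I)"
    unfolding differentiable_def by blast
  then have "((\<lambda>C. moment_map k (chart_point I C)) has_derivative D) (at B within chart_space I)"
    \<comment> \<open>The formula in terms of weights describes the moment map on the chart space
      only, so the derivative is transferred within that space.\<close>
    by (rule has_derivative_transform[OF B, rotated]) (rule moment_map_chart[OF I])
  then show ?thesis by blast
qed

section \<open>The orthogonal complement of the image of the differential\<close>

lemma chart_space_subspace: "subspace (chart_space I)"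
  by (auto simp: subspace_def chart_space_def)

lemma has_vector_derivative_along:
  assumes "(f has_derivative D) (at (\<gamma> x) within S)" and "range \<gamma> \<subseteq> S"
    and "(\<gamma> has_vector_derivative v) (at x)"
  shows "((\<lambda>s. f (\<gamma> s)) has_vector_derivative D v) (at x)"
proof -
  have "((\<lambda>s. f (\<gamma> s)) has_derivative (\<lambda>h. D (h *\<^sub>R v))) (at x)"
    using assms(3)[unfolded has_vector_derivative_def] has_derivative_subset[OF assms(1,2)]
    by (rule has_derivative_in_compose)
  moreover have "linear D" using assms(1) by (rule has_derivative_linear)
  ultimately show ?thesis by (simp add: has_vector_derivative_def linear_scale)
qed

lemma has_vector_derivative_vec:
  fixes f :: "real \<Rightarrow> 'a::euclidean_space^'n"
  assumes "\<And>i. ((\<lambda>s. f s $ i) has_vector_derivative f' $ i) (at x within S)"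
  shows "(f has_vector_derivative f') (at x within S)"
  using assms unfolding has_vector_derivative_def
  by (subst has_derivative_componentwise_within)
     (auto simp: Basis_vec_def inner_axis scaleR_left.sum
       dest!: has_derivative_inner_left simp flip: inner_scaleR_left)

text \<open>A weight that vanishes at \<open>B\<close> has a minimum there, so only the Pluecker coordinates that are
  nonzero at \<open>B\<close> contribute to the differential.\<close>

lemma differential_orthogonal_if_edge_const:
  fixes \<xi> :: "real^('n::{finite,linorder})"
  assumes I: "I \<in> ksubsets k" and B: "B \<in> chart_space I"
    and D: "((\<lambda>C. moment_map k (chart_point I C)) has_derivative D) (at B within chart_space I)"
    and \<xi>: "edge_const I B \<xi>" and v: "v \<in> chart_space I"
  shows "D v \<bullet> \<xi> = 0"
proof -
  define \<gamma> where "\<gamma> s = B + s *\<^sub>R v" for s :: real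
  have \<gamma>: "\<gamma> s \<in> chart_space I" for s
    unfolding \<gamma>_def using B v chart_space_subspace subspace_add subspace_scale by blast
  have \<gamma>': "(\<gamma> has_vector_derivative v) (at 0)"
    unfolding \<gamma>_def by (auto intro!: derivative_eq_intros)
  have \<gamma>0: "\<gamma> 0 = B" by (simp add: \<gamma>_def)
  obtain c where c: "\<And>J. J \<in> ksubsets k \<Longrightarrow> pluecker k (chart_point I B) J \<noteq> 0 \<Longrightarrow> (\<Sum>j\<in>J. \<xi> $ j) = c"
    using sum_const_if_edge_const[OF I B \<xi>] by blast
  define w where "w J s = weight k I (\<gamma> s) J" for J s
  define N where "N s = (\<Sum>J\<in>ksubsets k. w J s)" for s
  have N: "N s > 0" for s
    using sum_weight_pos[OF I \<gamma>, of "\<lambda>_. 1"] by (simp add: N_def w_def)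
  have "\<exists>w'. (w J has_real_derivative w') (at 0)" for J
  proof -
    obtain W where "((\<lambda>C. weight k I C J) has_derivative W) (at (\<gamma> 0) within UNIV)"
      using weight_differentiable unfolding differentiable_def by blast
    then show ?thesis
      unfolding w_def has_real_derivative_iff_has_vector_derivative
      using has_vector_derivative_along[OF _ _ \<gamma>'] by blast
  qed
  then obtain w' where w': "\<And>J. (w J has_real_derivative w' J) (at 0)" by metis
  have zero: "w J 0 * ((\<Sum>j\<in>J. \<xi> $ j) - c) = 0 \<and> w' J * ((\<Sum>j\<in>J. \<xi> $ j) - c) = 0"
    if "J \<in> ksubsets k" for J
  proof (cases "pluecker k (chart_point I B) J = 0")
    case True
    then have "w J 0 = 0"
      using weight_eq_0_iff[OF I B that] by (simp add: w_def \<gamma>0)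
    moreover have "w' J = 0"
      using \<open>w J 0 = 0\<close> weight_nonneg
      by (intro DERIV_local_min[OF w'[of J], of 1]) (auto simp: w_def)
    ultimately show ?thesis by simp
  qed (simp add: c that)
  \<comment> \<open>As \<open>c\<close> is the common value of the sums on the support at
    \<open>B\<close>, both \<open>G\<close> and its derivative vanish at 0. The moment map paired
    with \<open>\<xi>\<close> is \<open>c + G s / N s\<close>, so its derivative at 0 vanishes as
    well.\<close>
  define G where "G s = (\<Sum>J\<in>ksubsets k. w J s * ((\<Sum>j\<in>J. \<xi> $ j) - c))" for s
  have G0: "G 0 = 0" unfolding G_def by (intro sum.neutral ballI) (use zero in blast)
  have G': "(G has_real_derivative 0) (at 0)"
  proof -
    have "(G has_real_derivative (\<Sum>J\<in>ksubsets k. w' J * ((\<Sum>j\<in>J. \<xi> $ j) - c))) (at 0)"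
      unfolding G_def by (intro DERIV_sum DERIV_cmult_right w')
    moreover have "(\<Sum>J\<in>ksubsets k. w' J * ((\<Sum>j\<in>J. \<xi> $ j) - c)) = 0"
      by (intro sum.neutral ballI) (use zero in blast)
    ultimately show ?thesis by simp
  qed
  have N': "(N has_real_derivative (\<Sum>J\<in>ksubsets k. w' J)) (at 0)"
    unfolding N_def by (intro DERIV_sum w')
  have "((\<lambda>s. c + G s / N s) has_real_derivative 0) (at 0)"
    using N[of 0] by (auto intro!: derivative_eq_intros G' N' simp: G0)
  moreover have "moment_map k (chart_point I (\<gamma> s)) \<bullet> \<xi> = c + G s / N s" for s
  proof -
    have "G s = (\<Sum>J\<in>ksubsets k. w J s * (\<Sum>j\<in>J. \<xi> $ j)) - c * N s"
      by (simp add: G_def N_def algebra_simps sum_subtractf sum_distrib_left)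
    then show ?thesis
      using N[of s] unfolding moment_map_chart_inner[OF I \<gamma>] by (simp add: N_def w_def field_simps)
  qed
  ultimately have "((\<lambda>s. moment_map k (chart_point I (\<gamma> s)) \<bullet> \<xi>) has_vector_derivative 0) (at 0)"
    by (simp add: has_real_derivative_iff_has_vector_derivative)
  moreover have "((\<lambda>s. moment_map k (chart_point I (\<gamma> s)) \<bullet> \<xi>) has_vector_derivative D v \<bullet> \<xi>) (at 0)"
    using has_vector_derivative_along[of _ D \<gamma> 0, OF _ _ \<gamma>'] D \<gamma> \<gamma>0
    by (intro bounded_linear.has_vector_derivative[OF bounded_linear_inner_left]) auto
  ultimately show ?thesis by (rule vector_derivative_unique_at[symmetric])
qed

lemma minor_torus_exp:
  assumes "J \<in> ksubsets k"
  shows "(cmod (minor k (\<lambda>i. torus_exp (s *\<^sub>R \<xi>) * b i) J))\<^sup>2 =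
    (cmod (minor k b J))\<^sup>2 * exp (2 * s * (\<Sum>j\<in>J. \<xi> $ j))"
proof -
  have "(exp (s * (\<Sum>j\<in>J. \<xi> $ j)))\<^sup>2 = exp (2 * s * (\<Sum>j\<in>J. \<xi> $ j))"
    by (simp add: mult.assoc flip: exp_double)
  then show ?thesis
    by (simp add: minor_torus[OF assms] prod_torus_exp norm_mult power_mult_distrib
        flip: sum_distrib_left)
qed

text \<open>Along the curve \<open>exp (s \<xi>) L\<close> the derivative of \<open>\<langle>\<mu>, \<xi>\<rangle>\<close> at \<open>s = 0\<close> is twice the variance of
  \<open>J \<mapsto> \<langle>\<Lambda>\<^sub>J, \<xi>\<rangle>\<close> with respect to the weights \<open>|P\<^sup>J(L)|\<^sup>2\<close>.\<close>

lemma edge_const_if_differential_orthogonal: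
  fixes \<xi> :: "real^('n::{finite,linorder})"
  assumes I: "I \<in> ksubsets k" and B: "B \<in> chart_space I"
    and D: "((\<lambda>C. moment_map k (chart_point I C)) has_derivative D) (at B within chart_space I)"
    and orth: "\<And>v. v \<in> chart_space I \<Longrightarrow> D v \<bullet> \<xi> = 0"
  shows "edge_const I B \<xi>"
proof -
  \<comment> \<open>The chart coordinates of the chart point translated by the exponential of
    \<open>s\<close> times \<open>\<xi>\<close>; \<open>v\<close> is the velocity at
    \<open>s = 0\<close>.\<close>
  define \<gamma> where "\<gamma> s = (\<chi> i j. exp (s * (\<xi> $ j - \<xi> $ i)) *\<^sub>R B $ i $ j)" for s
  define v where "v = (\<chi> i j. (\<xi> $ j - \<xi> $ i) *\<^sub>R B $ i $ j)"
  have \<gamma>: "\<gamma> s \<in> chart_space I" for s using B by (simp add: \<gamma>_def chart_space_def)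
  have v: "v \<in> chart_space I" using B by (simp add: v_def chart_space_def)
  have \<gamma>0: "\<gamma> 0 = B" by (simp add: \<gamma>_def vec_eq_iff)
  have \<gamma>': "(\<gamma> has_vector_derivative v) (at 0)"
    unfolding \<gamma>_def v_def
    by (intro has_vector_derivative_vec)
       (auto intro!: derivative_eq_intros simp: has_real_derivative_iff_has_vector_derivative[symmetric])
  define L where "L = chart_point I B"
  define a where "a J = weight k I B J" for J
  define e where "e J = (\<Sum>j\<in>J. \<xi> $ j)" for J
  \<comment> \<open>In the translated basis the squared modulus of the minor at \<open>J\<close> is
    \<open>a J * exp (2 * s * e J)\<close>. \<open>N\<close> is the total mass, \<open>E\<close> the
    first moment of \<open>e\<close>, and \<open>V\<close> its second moment at
    \<open>s = 0\<close>.\<close>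
  define N where "N s = (\<Sum>J\<in>ksubsets k. a J * exp (2 * s * e J))" for s
  define E where "E s = (\<Sum>J\<in>ksubsets k. a J * exp (2 * s * e J) * e J)" for s
  define V where "V = (\<Sum>J\<in>ksubsets k. a J * (e J * e J))"
  have N: "N s > 0" for s
    using sum_weight_pos[OF I B] by (simp add: N_def a_def)
  have mu: "moment_map k (chart_point I (\<gamma> s)) \<bullet> \<xi> = E s / N s" for s
  proof -
    let ?t = "torus_exp (s *\<^sub>R \<xi>)" and ?b = "chart_basis I B"
    have "torus_act ?t (chart_point I B) = chart_point I (\<gamma> s)"
    proof (rule torus_act_chart_point[OF I B \<gamma> torus_exp_nz])
      fix i j
      have "exp (s * \<xi> $ j) = exp (s * \<xi> $ i) * exp (s * (\<xi> $ j - \<xi> $ i))"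
        by (simp add: algebra_simps flip: exp_add)
      then show "?t $ j * B $ i $ j = ?t $ i * \<gamma> s $ i $ j"
        by (simp add: \<gamma>_def torus_exp_def) (simp add: scaleR_conv_of_real)
    qed
    \<comment> \<open>The translated basis need not be the chart basis of \<open>\<gamma> s\<close>,
      but the moment map may be computed in any basis with a nonzero minor.\<close>
    then have basis: "is_basis k (\<lambda>i. ?t * ?b i) (chart_point I (\<gamma> s))"
      using is_basis_torus[OF is_basis_chart[OF I B] torus_exp_nz] by metis
    have "minor k (\<lambda>i. ?t * ?b i) I \<noteq> 0"
      by (simp add: minor_torus[OF I] minor_chart_basis[OF I B] torus_exp_nz)
    then show ?thesis
      by (simp add: moment_map_basis[OF basis I] minor_torus_exp inner_sum_left inner_vertex
          E_def N_def a_def e_def weight_def)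
  qed
  have "(N has_real_derivative 2 * E 0) (at 0)"
    unfolding N_def E_def sum_distrib_left
    by (intro DERIV_sum) (auto intro!: derivative_eq_intros)
  moreover have "(E has_real_derivative 2 * V) (at 0)"
    unfolding E_def V_def sum_distrib_left
    by (intro DERIV_sum) (auto intro!: derivative_eq_intros)
  ultimately have "((\<lambda>s. E s / N s) has_real_derivative (2 * V * N 0 - E 0 * (2 * E 0)) / (N 0 * N 0)) (at 0)"
    using N[of 0] by (intro DERIV_divide) auto
  then have "((\<lambda>s. moment_map k (chart_point I (\<gamma> s)) \<bullet> \<xi>) has_vector_derivative
      (2 * V * N 0 - E 0 * (2 * E 0)) / (N 0 * N 0)) (at 0)"
    by (simp add: mu has_real_derivative_iff_has_vector_derivative)
  moreover have "((\<lambda>s. moment_map k (chart_point I (\<gamma> s)) \<bullet> \<xi>) has_vector_derivative D v \<bullet> \<xi>) (at 0)"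
    using has_vector_derivative_along[of _ D \<gamma> 0, OF _ _ \<gamma>'] D \<gamma> \<gamma>0
    by (intro bounded_linear.has_vector_derivative[OF bounded_linear_inner_left]) auto
  ultimately have "(2 * V * N 0 - E 0 * (2 * E 0)) / (N 0 * N 0) = D v \<bullet> \<xi>"
    by (rule vector_derivative_unique_at)
  then have VNE: "V * N 0 = E 0 * E 0" using orth[OF v] N[of 0] by simp
  \<comment> \<open>The weighted mean of \<open>e\<close>. The equality
    \<open>V * N 0 = E 0 * E 0\<close> says that the variance is zero, so \<open>e\<close> takes the
    value \<open>m\<close> wherever the weight is nonzero.\<close>
  define m where "m = E 0 / N 0"
  have "(\<Sum>J\<in>ksubsets k. a J * (e J - m)\<^sup>2) = V - 2 * m * E 0 + m\<^sup>2 * N 0"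
    by (simp add: V_def E_def N_def power2_eq_square algebra_simps sum.distrib sum_subtractf sum_distrib_left)
  also have "\<dots> = 0"
    using VNE N[of 0] by (simp add: m_def field_simps power2_eq_square)
  finally have "\<forall>J\<in>ksubsets k. a J * (e J - m)\<^sup>2 = 0"
    by (subst (asm) sum_nonneg_eq_0_iff) (auto simp: a_def weight_nonneg)
  then have "(\<Sum>j\<in>J. \<xi> $ j) = m" if "J \<in> ksubsets k" "pluecker k (chart_point I B) J \<noteq> 0" for J
    using that weight_eq_0_iff[OF I B] by (force simp: a_def e_def)
  then show ?thesis using edge_const_if_sum_const[OF I B] by blast
qed

section \<open>Full rank as triviality of the stabilizer\<close>

text \<open>The orthogonal complement of \<open>V\<close> contains the line of constant vectors, and
  \<open>V\<close> has codimension 1 iff the complement is no larger than this line.\<close>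

lemma dim_eq_iff_orthogonal_const:
  fixes V :: "(real^'n) set"
  assumes V: "subspace V" and const: "\<And>v. v \<in> V \<Longrightarrow> v \<bullet> (\<chi> i. 1) = 0"
  shows "dim V = CARD('n) - 1 \<longleftrightarrow> (\<forall>\<xi>. (\<forall>v\<in>V. v \<bullet> \<xi> = 0) \<longrightarrow> (\<exists>c. \<xi> = (\<chi> i. c)))"
proof -
  let ?E = "{\<xi>. \<forall>v\<in>V. v \<bullet> \<xi> = 0}" and ?one = "(\<chi> i. 1) :: real^'n"
  have dims: "dim ?E + dim V = CARD('n)"
    using dim_subspace_orthogonal_to_vectors[OF V subspace_UNIV] by (simp add: orthogonal_def)
  have span: "span {?one} = {\<xi>. \<exists>c. \<xi> = (\<chi> i. c)}"
    by (auto simp: span_singleton vec_eq_iff)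
  have one: "dim (span {?one}) = 1"
    by (simp add: vec_eq_iff)
  have sub: "span {?one} \<subseteq> ?E" and E: "subspace ?E"
    using const by (auto simp: span_singleton subspace_def inner_right_distrib)
  \<comment> \<open>The line of constants gives \<open>1 \<le> dim ?E\<close>, so the subtraction
    does not truncate.\<close>
  have "dim V = CARD('n) - 1 \<longleftrightarrow> dim ?E = 1"
    using dims dim_subset[OF sub] one by linarith
  also have "\<dots> \<longleftrightarrow> ?E \<subseteq> span {?one}"
  proof
    assume "dim ?E = 1"
    then show "?E \<subseteq> span {?one}"
      using subspace_dim_equal[OF subspace_span E sub] one by simp
  next
    assume "?E \<subseteq> span {?one}"
    then have "?E = span {?one}" using sub by blast
    then show "dim ?E = 1" using one by simp
  qed
  finally show ?thesis by (auto simp: span)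
qed

text \<open>From a torus solution, the indicator of each level set of \<open>t\<close> is a real
  solution, and if all of these are constant then so is \<open>t\<close>. From a real solution, the
  exponential is a torus solution.\<close>

lemma edge_const_trivial_iff:
  "(\<forall>\<xi> :: real^'n. edge_const I B \<xi> \<longrightarrow> (\<exists>c. \<xi> = (\<chi> i. c))) \<longleftrightarrow>
   (\<forall>t :: complex^'n. (\<forall>i. t $ i \<noteq> 0) \<longrightarrow> edge_const I B t \<longrightarrow> (\<exists>c. t = (\<chi> i. c)))"
proof (intro iffI allI impI)
  fix t :: "complex^'n"
  assume real: "\<forall>\<xi> :: real^'n. edge_const I B \<xi> \<longrightarrow> (\<exists>c. \<xi> = (\<chi> i. c))" and t: "edge_const I B t"
  have "\<exists>c. (\<chi> i. if t $ i = t $ l then 1 else (0::real)) = (\<chi> i. c)" for l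
    by (rule real[rule_format]) (use t in \<open>auto simp: edge_const_def\<close>)
  then obtain c where "\<And>l. (\<chi> i. if t $ i = t $ l then 1 else (0::real)) = (\<chi> i. c l)"
    by metis
  then have "(if t $ i = t $ l then 1 else (0::real)) = c l" for i l
    by (simp add: vec_eq_iff)
  then have "(if t $ i = t $ l then 1 else (0::real)) = (if t $ l = t $ l then 1 else 0)" for i l
    by metis
  then have "t $ i = t $ l" for i l by (metis zero_neq_one)
  then show "\<exists>c. t = (\<chi> i. c)" by (auto simp: vec_eq_iff)
next
  fix \<xi> :: "real^'n"
  assume cplx: "\<forall>t :: complex^'n. (\<forall>i. t $ i \<noteq> 0) \<longrightarrow> edge_const I B t \<longrightarrow> (\<exists>c. t = (\<chi> i. c))"
    and \<xi>: "edge_const I B \<xi>"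
  have "edge_const I B (torus_exp \<xi>)" using \<xi> by (auto simp: edge_const_def torus_exp_def)
  then obtain c where "torus_exp \<xi> = (\<chi> i. c)" using cplx torus_exp_nz by blast
  then have "complex_of_real (exp (\<xi> $ i)) = complex_of_real (exp (\<xi> $ j))" for i j
    by (simp add: torus_exp_def vec_eq_iff)
  then have "\<xi> $ i = \<xi> $ j" for i j
    by (metis exp_inj_iff of_real_eq_iff)
  then show "\<exists>c. \<xi> = (\<chi> i. c)" by (auto simp: vec_eq_iff)
qed

lemma full_rank_chart_iff:
  fixes B :: "complex^('n::{finite,linorder})^('n::{finite,linorder})"
  assumes I: "I \<in> ksubsets k" and B: "B \<in> chart_space I"
    and D: "((\<lambda>C. moment_map k (chart_point I C)) has_derivative D) (at B within chart_space I)"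
  shows "dim (D ` chart_space I) = CARD('n) - 1 \<longleftrightarrow>
    (\<forall>t. (\<forall>i. t $ i \<noteq> 0) \<longrightarrow> torus_act t (chart_point I B) = chart_point I B \<longrightarrow> (\<exists>c. t = (\<chi> i. c)))"
proof -
  have orth: "(\<forall>v\<in>D ` chart_space I. v \<bullet> \<xi> = 0) \<longleftrightarrow> edge_const I B \<xi>" for \<xi>
    using differential_orthogonal_if_edge_const[OF I B D] edge_const_if_differential_orthogonal[OF I B D]
    by blast
  have act: "(\<forall>t. (\<forall>i. t $ i \<noteq> 0) \<longrightarrow> torus_act t (chart_point I B) = chart_point I B \<longrightarrow> P t) \<longleftrightarrow>
      (\<forall>t. (\<forall>i. t $ i \<noteq> 0) \<longrightarrow> edge_const I B t \<longrightarrow> P t)" for P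
    using torus_act_chart_point_iff[OF I B] by blast
  have sub: "subspace (D ` chart_space I)"
    using D by (intro linear_subspace_image has_derivative_linear chart_space_subspace)
  \<comment> \<open>Constant vectors satisfy the edge equations trivially, which places the image in
    the hyperplane of sum zero.\<close>
  have const: "v \<bullet> (\<chi> i. 1) = 0" if "v \<in> D ` chart_space I" for v
    using orth[of "\<chi> i. 1"] that unfolding edge_const_def by fastforce
  show ?thesis
    using dim_eq_iff_orthogonal_const[OF sub const] unfolding act orth edge_const_trivial_iff .
qed

text \<open>The stabilizer condition does not refer to a chart, so the criterion applies to
  whichever chart witnesses the rank; in the other direction any chart around \<open>L\<close> will
  do.\<close>

lemma full_rank_iff:
  fixes L :: "(complex^('n::{finite,linorder})) set"
  assumes L: "L \<in> grassmannian k"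
  shows "has_differential_rank k (moment_map k) L (CARD('n) - 1) \<longleftrightarrow>
    (\<forall>t. (\<forall>i. t $ i \<noteq> 0) \<longrightarrow> torus_act t L = L \<longrightarrow> (\<exists>c. t = (\<chi> i. c)))"
  (is "_ \<longleftrightarrow> ?triv")
proof
  assume "has_differential_rank k (moment_map k) L (CARD('n) - 1)"
  then show ?triv
    unfolding has_differential_rank_def using full_rank_chart_iff by metis
next
  assume ?triv
  obtain I B where IB: "I \<in> ksubsets k" "B \<in> chart_space I" "chart_point I B = L"
    using chart_exists[OF L] .
  then show "has_differential_rank k (moment_map k) L (CARD('n) - 1)"
    unfolding has_differential_rank_def
    using moment_map_chart_differentiable[OF IB(1,2)] full_rank_chart_iff[OF IB(1,2)] \<open>?triv\<close>
    by blast
qed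

section \<open>Stationary subgroups\<close>

lemma one_effective_torus: "\<one>\<^bsub>effective_torus\<^esub> = (diag_torus :: (complex^'n) set)"
  by (simp add: effective_torus_def FactGroup_def)

definition diag_coset :: "complex^'n \<Rightarrow> (complex^'n) set" where
  "diag_coset t = {c *s t | c. c \<noteq> 0}"

lemma carrier_effective_torus:
  "T \<in> carrier effective_torus \<longleftrightarrow>
    (\<exists>t. (\<forall>i. t $ i \<noteq> 0) \<and> T = diag_coset t)" for T :: "(complex^'n) set"
proof -
  have "diag_torus #>\<^bsub>torus\<^esub> t = diag_coset t" for t :: "complex^'n"
  proof -
    have "(\<chi> i. c) * t = c *s t" for c by (simp add: vec_eq_iff)
    then show ?thesis
      unfolding r_coset_def torus_def diag_torus_def diag_coset_def by (auto simp: Bex_def)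
  qed
  then show ?thesis
    by (auto simp: effective_torus_def FactGroup_def RCOSETS_def torus_def)
qed

lemma diag_coset_eq_diag_torus_iff:
  fixes t :: "complex^'n"
  assumes "\<forall>i. t $ i \<noteq> 0"
  shows "diag_coset t = diag_torus \<longleftrightarrow> (\<exists>c. t = (\<chi> i. c))"
proof
  assume "diag_coset t = diag_torus"
  moreover have "t \<in> diag_coset t" by (auto simp: diag_coset_def intro: exI[of _ 1])
  ultimately show "\<exists>c. t = (\<chi> i. c)" by (auto simp: diag_torus_def)
next
  assume "\<exists>c. t = (\<chi> i. c)"
  then obtain d where d: "t = (\<chi> i. d)" by blast
  then have "d \<noteq> 0" using assms by simp
  show "diag_coset t = diag_torus"
  proof (intro equalityI subsetI)
    fix v assume "v \<in> diag_coset t"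
    then obtain c where "c \<noteq> 0" "v = c *s t" unfolding diag_coset_def by blast
    then have "v = (\<chi> i. c * d)" "c * d \<noteq> 0" using \<open>d \<noteq> 0\<close> by (simp_all add: d vec_eq_iff)
    then show "v \<in> diag_torus" unfolding diag_torus_def diag_coset_def by blast
  next
    fix v :: "complex^'n" assume "v \<in> diag_torus"
    then obtain c where "c \<noteq> 0" "v = (\<chi> i. c)" unfolding diag_torus_def diag_coset_def by blast
    then have "v = (c / d) *s t" "c / d \<noteq> 0" using \<open>d \<noteq> 0\<close> by (simp_all add: d vec_eq_iff)
    then show "v \<in> diag_coset t" unfolding diag_coset_def by blast
  qed
qed

text \<open>A subspace is invariant under nonzero scalars, so all representatives of a coset act on
  it alike and one of them decides.\<close>

lemma diag_coset_stabilizer_iff: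
  assumes L: "L \<in> grassmannian k" and t: "\<forall>i. t $ i \<noteq> 0"
  shows "diag_coset t \<in> stabilizer L \<longleftrightarrow> torus_act t L = L"
proof -
  have sub: "vec.subspace L" using L by (simp add: grassmannian_def)
  have scale: "(*s) c ` L = L" if "c \<noteq> 0" for c
  proof (intro equalityI subsetI)
    fix v assume "v \<in> L"
    then have "(1 / c) *s v \<in> L" using sub vec.subspace_scale by blast
    moreover have "v = c *s ((1 / c) *s v)" using that by simp
    ultimately show "v \<in> (*s) c ` L" by blast
  qed (use sub vec.subspace_scale in blast)
  have act: "torus_act (c *s t) L = torus_act t L" if "c \<noteq> 0" for c
  proof -
    have "torus_act (c *s t) L = (*) t ` (*s) c ` L"
      unfolding torus_act_def image_image by (intro image_cong) (auto simp: vec_eq_iff)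
    then show ?thesis using scale[OF that] by (simp add: torus_act_def)
  qed
  have "diag_coset t \<in> carrier effective_torus"
    using t carrier_effective_torus by blast
  then have "diag_coset t \<in> stabilizer L \<longleftrightarrow> (\<forall>c. c \<noteq> 0 \<longrightarrow> torus_act (c *s t) L = L)"
    by (auto simp: stabilizer_def diag_coset_def)
  also have "\<dots> \<longleftrightarrow> torus_act t L = L"
    using act by (metis zero_neq_one)
  finally show ?thesis .
qed

lemma stationary_subgroup_trivial_iff:
  fixes S :: "(complex^'n) set set"
  assumes S: "S \<subseteq> grassmannian k" "S \<noteq> {}"
  shows "stationary_subgroup S = {\<one>\<^bsub>effective_torus\<^esub>} \<longleftrightarrow>
    (\<forall>t. (\<forall>i. t $ i \<noteq> 0) \<longrightarrow> (\<forall>L\<in>S. torus_act t L = L) \<longrightarrow> (\<exists>c. t = (\<chi> i. c)))"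
  (is "_ \<longleftrightarrow> ?triv")
proof -
  have stab: "diag_coset t \<in> stabilizer L \<longleftrightarrow> torus_act t L = L"
    if "L \<in> S" "\<forall>i. t $ i \<noteq> 0" for L t
    using that S(1) by (intro diag_coset_stabilizer_iff) auto
  have mem: "T \<in> stationary_subgroup S \<longleftrightarrow>
    (\<exists>t. (\<forall>i. t $ i \<noteq> 0) \<and> T = diag_coset t \<and> (\<forall>L\<in>S. torus_act t L = L))" for T
  proof
    assume T: "T \<in> stationary_subgroup S"
    \<comment> \<open>An empty intersection would be the whole type; a member of \<open>S\<close>
      puts \<open>T\<close> into the carrier.\<close>
    then have "T \<in> carrier effective_torus"
      using S(2) by (auto simp: stationary_subgroup_def stabilizer_def)
    then obtain t where t: "\<forall>i. t $ i \<noteq> 0" "T = diag_coset t"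
      using carrier_effective_torus by blast
    then have "\<forall>L\<in>S. torus_act t L = L"
      using T stab[OF _ t(1)] by (simp add: stationary_subgroup_def)
    with t show "\<exists>t. (\<forall>i. t $ i \<noteq> 0) \<and> T = diag_coset t \<and> (\<forall>L\<in>S. torus_act t L = L)"
      by blast
  next
    assume "\<exists>t. (\<forall>i. t $ i \<noteq> 0) \<and> T = diag_coset t \<and> (\<forall>L\<in>S. torus_act t L = L)"
    then obtain t where t: "\<forall>i. t $ i \<noteq> 0" "T = diag_coset t" "\<forall>L\<in>S. torus_act t L = L"
      by blast
    then show "T \<in> stationary_subgroup S"
      using stab[OF _ t(1)] by (simp add: stationary_subgroup_def)
  qed
  \<comment> \<open>The unit always belongs to the stationary subgroup, so triviality only requires
    that every member equal the unit.\<close>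
  have "diag_coset 1 \<in> stationary_subgroup S"
    unfolding mem by (intro exI[of _ 1]) (simp add: torus_act_def)
  moreover have "diag_coset 1 = (diag_torus :: (complex^'n) set)"
    by (subst diag_coset_eq_diag_torus_iff) (auto simp: vec_eq_iff)
  ultimately have "diag_torus \<in> stationary_subgroup S" by simp
  then have "stationary_subgroup S = {diag_torus} \<longleftrightarrow> (\<forall>T\<in>stationary_subgroup S. T = diag_torus)"
    by blast
  also have "\<dots> \<longleftrightarrow> ?triv"
  proof (intro iffI allI impI ballI)
    fix t :: "complex^'n"
    assume "\<forall>T\<in>stationary_subgroup S. T = diag_torus" "\<forall>i. t $ i \<noteq> 0" "\<forall>L\<in>S. torus_act t L = L"
    then show "\<exists>c. t = (\<chi> i. c)"
      using diag_coset_eq_diag_torus_iff[of t] mem by blast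
  next
    fix T :: "(complex^'n) set" assume triv: ?triv and T: "T \<in> stationary_subgroup S"
    obtain t where t: "\<forall>i. t $ i \<noteq> 0" "T = diag_coset t" "\<forall>L\<in>S. torus_act t L = L"
      using mem[THEN iffD1, OF T] by blast
    have "\<exists>c. t = (\<chi> i. c)" using triv[rule_format, OF t(1)[rule_format] t(3)[rule_format]] .
    then show "T = diag_torus"
      using diag_coset_eq_diag_torus_iff[OF t(1)] t(2) by simp
  qed
  finally show ?thesis by (simp add: one_effective_torus)
qed

section \<open>Strata and regular values\<close>

text \<open>All members of a stratum have the same support, so a torus element fixing
  \<open>L\<close> fixes every other member too, and a single point determines the stationary
  subgroup.\<close>

lemma stratum_stationary_subgroup_trivial_iff:
  fixes L :: "(complex^('n::{finite,linorder})) set"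
  assumes "S \<in> strata k" and "L \<in> S"
  shows "stationary_subgroup S = {\<one>\<^bsub>effective_torus\<^esub>} \<longleftrightarrow>
    (\<forall>t. (\<forall>i. t $ i \<noteq> 0) \<longrightarrow> torus_act t L = L \<longrightarrow> (\<exists>c. t = (\<chi> i. c)))"
proof -
  obtain \<sigma> where S: "S = stratum k \<sigma>" using assms(1) by (auto simp: strata_def)
  then have L: "L \<in> grassmannian k" and sub: "S \<subseteq> grassmannian k" and ne: "S \<noteq> {}"
    using assms(2) by (auto simp: stratum_def)
  have "(\<forall>L'\<in>S. torus_act t L' = L') \<longleftrightarrow> torus_act t L = L" if t: "\<forall>i. t $ i \<noteq> 0" for t
  proof (intro iffI ballI)
    fix L' assume fixed: "torus_act t L = L" and "L' \<in> S"
    then have "L' \<in> grassmannian k"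
      and "\<And>J. J \<in> ksubsets k \<Longrightarrow> pluecker k L' J \<noteq> 0 \<Longrightarrow> pluecker k L J \<noteq> 0"
      using assms(2) by (auto simp: S stratum_def)
    then show "torus_act t L' = L'"
      using torus_fixed_same_support[OF L _ _ t[rule_format] fixed] by blast
  qed (use assms(2) in blast)
  then show ?thesis
    unfolding stationary_subgroup_trivial_iff[OF sub ne] by (intro all_cong1 imp_cong refl)
qed

lemma stratum_exists:
  assumes "L \<in> grassmannian k"
  shows "\<exists>S\<in>strata k. L \<in> S"
  using assms
  by (auto simp: strata_def stratum_def intro!: exI[of _ "{I \<in> ksubsets k. pluecker k L I \<noteq> 0}"])

theorem theorem3p11:
  fixes k :: nat and x :: "real^('n::{finite,linorder})"
  assumes "1 \<le> k" and "k \<le> CARD('n) - 1"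
    and "x \<in> rel_interior (hypersimplex k)"
  shows "regular_value k x \<longleftrightarrow>
    (\<forall>S\<in>(strata k :: (complex^('n::{finite,linorder})) set set set).
       stationary_subgroup S \<noteq> {\<one>\<^bsub>effective_torus\<^esub>} \<longrightarrow>
       {L \<in> grassmannian k. moment_map k L = x} \<inter> S = {})"
proof -
  \<comment> \<open>Both sides say that only diagonal torus elements fix \<open>L\<close>. The
    theorem thus holds point by point, and since the strata cover the Grassmannian it remains to
    quantify over the fibre of \<open>x\<close>.\<close>
  have rank: "has_differential_rank k (moment_map k) L (CARD('n) - 1) \<longleftrightarrow>
      stationary_subgroup S = {\<one>\<^bsub>effective_torus\<^esub>}"
    if "L \<in> grassmannian k" "S \<in> strata k" "L \<in> S" for L :: "(complex^('n::{finite,linorder})) set" and S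
    using full_rank_iff[OF that(1)] stratum_stationary_subgroup_trivial_iff[OF that(2,3)] by simp
  show ?thesis
  proof (intro iffI ballI impI)
    fix S :: "(complex^('n::{finite,linorder})) set set"
    assume "regular_value k x" "S \<in> strata k" "stationary_subgroup S \<noteq> {\<one>\<^bsub>effective_torus\<^esub>}"
    then show "{L \<in> grassmannian k. moment_map k L = x} \<inter> S = {}"
      using rank unfolding regular_value_def by fast
  next
    assume *: "\<forall>S\<in>(strata k :: (complex^('n::{finite,linorder})) set set set).
      stationary_subgroup S \<noteq> {\<one>\<^bsub>effective_torus\<^esub>} \<longrightarrow>
      {L \<in> grassmannian k. moment_map k L = x} \<inter> S = {}"
    show "regular_value k x"
      unfolding regular_value_def
    proof (intro ballI impI)
      fix L :: "(complex^('n::{finite,linorder})) set"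
      assume L: "L \<in> grassmannian k" "moment_map k L = x"
      obtain S where S: "S \<in> strata k" "L \<in> S" using stratum_exists[OF L(1)] by blast
      have "L \<in> {L \<in> grassmannian k. moment_map k L = x} \<inter> S" using L S by simp
      then have "stationary_subgroup S = {\<one>\<^bsub>effective_torus\<^esub>}" using *[rule_format, OF S(1)] by fast
      then show "has_differential_rank k (moment_map k) L (CARD('n) - 1)"
        using rank[OF L(1) S] by simp
    qed
  qed
qed

end
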